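(* Let $X$ be a compact metric space with ${\rm dim}(X)=d<\infty$ and $T:X\to X$ an aperiodic local homeomorphism such that $T$ maps zero-dimensional subsets to zero-dimensional subsets. Let $U\subseteq X$ be open. Then for every $k\in\mathbb{N}$ and every open $V\subseteq X$ with $\partial U\subseteq V$, there is an open set $U'$ with \[U\subseteq U'\subseteq U\cup V\quad\text{and}\quad\partial U'\subseteq V\] such that the family $\{T^{-i}(\partial U'): i=0,1,\dots,k-1\}$ is in general position.
   Context: Aperiodic: no $x$ with $T^n(x)=x$ for some $n\ge1$. $T^{-i}(A)$ denotes the preimage of $A$ under $T^i$. ${\rm dim}$ is covering dimension. A family $B$ of subsets of $X$ (with ${\rm dim}(X)=d$) is in general position if for every finite subfamily $S\subseteq B$ with $m$ elements, ${\rm dim}(\bigcap S)\le\max\{-1,d-m\}$ (with ${\rm dim}(\varnothing)=-1$). *)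

theory Defs
  imports "HOL-Analysis.Analysis"
begin

text \<open>Covering dimension (Lebesgue): a space has covering dimension at most n
  iff every finite open cover has a finite open refinement of order at most n,
  i.e. every point lies in at most n+1 members of the refinement.
  For n = -1 this says exactly that the space is empty.\<close>
definition cover_dim_le :: "'a topology \<Rightarrow> int \<Rightarrow> bool" where
  "cover_dim_le Y n \<longleftrightarrow>
     (\<forall>\<U>. finite \<U> \<and> (\<forall>U\<in>\<U>. openin Y U) \<and> \<Union>\<U> = topspace Y \<longrightarrow>
        (\<exists>\<V>. finite \<V> \<and> (\<forall>V\<in>\<V>. openin Y V) \<and> \<Union>\<V> = topspace Y \<and>
              (\<forall>V\<in>\<V>. \<exists>U\<in>\<U>. V \<subseteq> U) \<and>
              (\<forall>x\<in>topspace Y. int (card {V\<in>\<V>. x \<in> V}) \<le> n + 1)))"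

definition has_cover_dim :: "'a topology \<Rightarrow> int \<Rightarrow> bool" where
  "has_cover_dim Y d \<longleftrightarrow> cover_dim_le Y d \<and> \<not> cover_dim_le Y (d - 1)"

definition local_homeomorphism_on :: "'a::topological_space set \<Rightarrow> ('a \<Rightarrow> 'a) \<Rightarrow> bool" where
  "local_homeomorphism_on X T \<longleftrightarrow> T ` X \<subseteq> X \<and>
     (\<forall>x\<in>X. \<exists>W. x \<in> W \<and> openin (top_of_set X) W \<and> openin (top_of_set X) (T ` W) \<and>
        homeomorphic_map (subtopology (top_of_set X) W) (subtopology (top_of_set X) (T ` W)) T)"

definition aperiodic_on :: "'a set \<Rightarrow> ('a \<Rightarrow> 'a) \<Rightarrow> bool" where
  "aperiodic_on X T \<longleftrightarrow> (\<forall>x\<in>X. \<forall>n::nat. n \<ge> 1 \<longrightarrow> (T ^^ n) x \<noteq> x)"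

definition preim_iter :: "'a set \<Rightarrow> ('a \<Rightarrow> 'a) \<Rightarrow> nat \<Rightarrow> 'a set \<Rightarrow> 'a set" where
  "preim_iter X T i A = {x\<in>X. (T ^^ i) x \<in> A}"

definition general_position :: "'a topology \<Rightarrow> int \<Rightarrow> 'i set \<Rightarrow> ('i \<Rightarrow> 'a set) \<Rightarrow> bool" where
  "general_position Y d I B \<longleftrightarrow>
     (\<forall>S. S \<subseteq> I \<and> finite S \<and> S \<noteq> {} \<longrightarrow>
        cover_dim_le (subtopology Y (\<Inter>i\<in>S. B i)) (max (-1) (d - int (card S))))"

end

theory Submission
  imports Defs
begin

text \<open>
  Separate the closure of \<open>U\<close> from the complement of \<open>U \<union> V\<close> by a real function and perturb it to
  some \<open>f\<close>; then \<open>U' = {f > 0}\<close> works as soon as every fibre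
  \<open>{x. f (T\<^sup>i x) = 0 for all i \<in> S}\<close> has dimension at most \<open>d - |S|\<close>.

  By aperiodicity and local injectivity, \<open>X\<close> is a finite union of compact sets \<open>K\<close> on which the maps
  \<open>T\<^sup>i\<close> (\<open>i < k\<close>) are injective with pairwise disjoint images. Hence by Tietze the functions
  \<open>f \<circ> T\<^sup>i\<close> on \<open>K\<close> can be perturbed independently of each other. Replace them by
  \<open>\<Sum>v. \<phi>\<^sub>v h\<^sub>i(v)\<close>, where \<open>\<phi>\<close> is a partition of unity subordinate to a fine cover of order \<open>d + 1\<close>
  and the vectors \<open>(h\<^sub>i(v))\<^sub>i\<close> are in linearly general position: at a common zero at least \<open>|S| + 1\<close>
  of the \<open>\<phi>\<^sub>v\<close> are nonzero. The sets where precisely the weights indexed by \<open>\<sigma>\<close> dominate all others,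
  for \<open>|S| < |\<sigma>| \<le> d + 1\<close>, then cover the fibre with order at most \<open>d + 1 - |S|\<close>. Having such a fine
  cover is an open condition on \<open>f\<close>, so a Baire argument yields all scales at once, and the finite
  closed sum theorem glues the sets \<open>K\<close>.
\<close>

section \<open>Covering dimension\<close>

text \<open>The refinement on \<open>A\<close> may put several sets inside one \<open>U i\<close>;
  merging them under a single index cannot raise the order. Keeping the index set \<open>I\<close>
  allows such shrinkings to be applied in succession, since further shrinking preserves an order
  bound already reached.\<close>

lemma refine_indexed_cover_on_closedin:
  assumes "closedin Z A" and dim: "cover_dim_le (subtopology Z A) n" and "finite I"
    and op: "\<And>i. i \<in> I \<Longrightarrow> openin Z (U i)" and cov: "(\<Union>i\<in>I. U i) = topspace Z"
  shows "\<exists>W. (\<forall>i\<in>I. openin Z (W i) \<and> W i \<subseteq> U i) \<and> (\<Union>i\<in>I. W i) = topspace Z \<and>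
    (\<forall>x\<in>A. int (card {i\<in>I. x \<in> W i}) \<le> n + 1)"
proof -
  have sub: "A \<subseteq> topspace Z"
    using assms(1) closedin_subset by blast
  then have tA: "topspace (subtopology Z A) = A"
    by auto
  have "finite ((\<lambda>i. A \<inter> U i) ` I) \<and> (\<forall>V\<in>(\<lambda>i. A \<inter> U i) ` I. openin (subtopology Z A) V) \<and>
      \<Union>((\<lambda>i. A \<inter> U i) ` I) = topspace (subtopology Z A)"
    using \<open>finite I\<close> op cov sub unfolding tA by (auto intro: openin_subtopology_Int2)
  then have "\<exists>\<V>. finite \<V> \<and> (\<forall>V\<in>\<V>. openin (subtopology Z A) V) \<and> \<Union>\<V> = A \<and>
      (\<forall>V\<in>\<V>. \<exists>U\<in>(\<lambda>i. A \<inter> U i) ` I. V \<subseteq> U) \<and> (\<forall>x\<in>A. int (card {V\<in>\<V>. x \<in> V}) \<le> n + 1)"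
    using dim unfolding cover_dim_le_def tA by (elim allE impE)
  then obtain \<V> where fin: "finite \<V>" and opV: "\<forall>V\<in>\<V>. openin (subtopology Z A) V"
    and covV: "\<Union>\<V> = A" and refV: "\<forall>V\<in>\<V>. \<exists>U\<in>(\<lambda>i. A \<inter> U i) ` I. V \<subseteq> U"
    and ord: "\<forall>x\<in>A. int (card {V\<in>\<V>. x \<in> V}) \<le> n + 1"
    by blast
  have "\<forall>V\<in>\<V>. \<exists>i. i \<in> I \<and> V \<subseteq> A \<inter> U i"
    using refV by blast
  then obtain p where p: "\<forall>V\<in>\<V>. p V \<in> I \<and> V \<subseteq> A \<inter> U (p V)"
    by metis
  define N where "N i = \<Union>{V\<in>\<V>. p V = i}" for i
  \<comment> \<open>Refine the cover on \<open>A\<close> only: deleting the closed set \<open>A - N i\<close> keeps \<open>U i\<close> open.\<close>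
  define W where "W i = U i - (A - N i)" for i
  have N: "openin (subtopology Z A) (N i)" "N i \<subseteq> A \<inter> U i" for i
    using opV p unfolding N_def by auto
  show ?thesis
  proof (intro exI[of _ W] conjI ballI)
    fix i assume i: "i \<in> I"
    have "closedin (subtopology Z A) (topspace (subtopology Z A) - N i)"
      by (intro closedin_diff closedin_topspace N)
    then have "closedin (subtopology Z A) (A - N i)"
      unfolding tA .
    then have "closedin Z (A - N i)"
      using assms(1) closedin_trans_full by blast
    then show "openin Z (W i)"
      unfolding W_def using op[OF i] by blast
    show "W i \<subseteq> U i"
      by (auto simp: W_def)
  next
    show "(\<Union>i\<in>I. W i) = topspace Z"
    proof
      show "(\<Union>i\<in>I. W i) \<subseteq> topspace Z"
        using cov by (auto simp: W_def)
      show "topspace Z \<subseteq> (\<Union>i\<in>I. W i)"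
      proof
        fix x assume x: "x \<in> topspace Z"
        show "x \<in> (\<Union>i\<in>I. W i)"
        proof (cases "x \<in> A")
          case True
          then obtain V where "V \<in> \<V>" "x \<in> V" using covV by blast
          then have "x \<in> W (p V)" "p V \<in> I"
            using p by (auto simp: W_def N_def)
          then show ?thesis by blast
        next
          case False
          then show ?thesis using x cov by (auto simp: W_def)
        qed
      qed
    qed
  next
    fix x assume x: "x \<in> A"
    have "{i\<in>I. x \<in> W i} \<subseteq> p ` {V\<in>\<V>. x \<in> V}"
      using x by (auto simp: W_def N_def)
    then have "card {i\<in>I. x \<in> W i} \<le> card {V\<in>\<V>. x \<in> V}"
      using fin by (intro surj_card_le) auto
    then show "int (card {i\<in>I. x \<in> W i}) \<le> n + 1"
      using ord x by fastforce
  qed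
qed

text \<open>Shrink the cover first to obtain the order bound on \<open>A\<close>, then shrink the
  result to obtain it on \<open>B\<close>. The second family lies memberwise inside the first, so
  the bound on \<open>A\<close> survives.\<close>

lemma cover_dim_le_closedin_Un:
  assumes A: "closedin Z A" "cover_dim_le (subtopology Z A) n"
    and B: "closedin Z B" "cover_dim_le (subtopology Z B) n"
    and Z: "topspace Z = A \<union> B"
  shows "cover_dim_le Z n"
  unfolding cover_dim_le_def
proof (intro allI impI, elim conjE)
  fix \<U> assume fin: "finite \<U>" and op: "\<forall>U\<in>\<U>. openin Z U" and cov: "\<Union>\<U> = topspace Z"
  obtain W where W: "\<forall>U\<in>\<U>. openin Z (W U) \<and> W U \<subseteq> U" "(\<Union>U\<in>\<U>. W U) = topspace Z"
    "\<forall>x\<in>A. int (card {U\<in>\<U>. x \<in> W U}) \<le> n + 1"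
    using refine_indexed_cover_on_closedin[OF A fin, of "\<lambda>U. U"] op cov by auto
  obtain W' where W': "\<forall>U\<in>\<U>. openin Z (W' U) \<and> W' U \<subseteq> W U" "(\<Union>U\<in>\<U>. W' U) = topspace Z"
    "\<forall>x\<in>B. int (card {U\<in>\<U>. x \<in> W' U}) \<le> n + 1"
    using refine_indexed_cover_on_closedin[OF B fin _ W(2)] W(1) by auto
  have "int (card {V\<in>W' ` \<U>. x \<in> V}) \<le> n + 1" if "x \<in> topspace Z" for x
  proof -
    have "card {V\<in>W' ` \<U>. x \<in> V} \<le> card (W' ` {U\<in>\<U>. x \<in> W' U})"
      by (intro card_mono) (use fin in auto)
    also have "\<dots> \<le> card {U\<in>\<U>. x \<in> W' U}"
      by (intro card_image_le) (use fin in auto)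
    finally have 1: "card {V\<in>W' ` \<U>. x \<in> V} \<le> card {U\<in>\<U>. x \<in> W' U}" .
    have 2: "card {U\<in>\<U>. x \<in> W' U} \<le> card {U\<in>\<U>. x \<in> W U}"
      by (intro card_mono) (use fin W'(1) in auto)
    from that Z consider "x \<in> A" | "x \<in> B" by auto
    then show ?thesis
      using 1 2 W(3) W'(3) by cases fastforce+
  qed
  then show "\<exists>\<V>. finite \<V> \<and> (\<forall>V\<in>\<V>. openin Z V) \<and> \<Union>\<V> = topspace Z \<and>
      (\<forall>V\<in>\<V>. \<exists>U\<in>\<U>. V \<subseteq> U) \<and> (\<forall>x\<in>topspace Z. int (card {V\<in>\<V>. x \<in> V}) \<le> n + 1)"
    using fin W'(1,2) W(1) by (intro exI[of _ "W' ` \<U>"]) blast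
qed

lemma cover_dim_le_finite_closed_Union:
  fixes C :: "'i \<Rightarrow> 'a::topological_space set"
  assumes "finite I" "\<And>i. i \<in> I \<Longrightarrow> closed (C i)"
    and "\<And>i. i \<in> I \<Longrightarrow> cover_dim_le (top_of_set (C i)) n"
  shows "cover_dim_le (top_of_set (\<Union>i\<in>I. C i)) n"
  using assms
proof (induction I)
  case empty
  then show ?case by (auto simp: cover_dim_le_def intro: exI[of _ "{}"])
next
  case (insert i I)
  let ?R = "\<Union>i\<in>I. C i"
  have "closed ?R" using insert by auto
  have "C i \<union> ?R = (\<Union>i\<in>insert i I. C i)" by auto
  moreover have "cover_dim_le (top_of_set (C i \<union> ?R)) n"
  proof (rule cover_dim_le_closedin_Un)
    show "closedin (top_of_set (C i \<union> ?R)) (C i)" "closedin (top_of_set (C i \<union> ?R)) ?R"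
      using insert \<open>closed ?R\<close> by (auto intro!: closed_subset)
    have "(C i \<union> ?R) \<inter> C i = C i" "(C i \<union> ?R) \<inter> ?R = ?R" by auto
    then show "cover_dim_le (subtopology (top_of_set (C i \<union> ?R)) (C i)) n"
      "cover_dim_le (subtopology (top_of_set (C i \<union> ?R)) ?R) n"
      using insert by (simp_all add: subtopology_subtopology)
  qed auto
  ultimately show ?case by simp
qed

text \<open>By compactness every open cover has a Lebesgue number, and a cover of smaller mesh
  refines it. The members \<open>V\<close> may stick out of \<open>A\<close>, so that covers of a
  larger space can be used directly.\<close>

lemma compact_cover_dim_leI:
  fixes A :: "'a::metric_space set"
  assumes "compact A"
    and small: "\<And>e. e > 0 \<Longrightarrow> \<exists>\<V>. finite \<V> \<and> (\<forall>V\<in>\<V>. openin (top_of_set A) (A \<inter> V)) \<and> A \<subseteq> \<Union>\<V> \<and>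
      (\<forall>V\<in>\<V>. \<forall>x\<in>V. \<forall>y\<in>V. dist x y < e) \<and> (\<forall>x\<in>A. int (card {V\<in>\<V>. x \<in> V}) \<le> n + 1)"
  shows "cover_dim_le (top_of_set A) n"
  unfolding cover_dim_le_def topspace_euclidean_subtopology
proof (intro allI impI, elim conjE)
  fix \<U> assume fin: "finite \<U>" and op: "\<forall>U\<in>\<U>. openin (top_of_set A) U" and cov: "\<Union>\<U> = A"
  obtain G where G: "\<And>U. U \<in> \<U> \<Longrightarrow> open (G U)" "\<And>U. U \<in> \<U> \<Longrightarrow> U = A \<inter> G U"
    using op unfolding openin_open by metis
  obtain e where e: "0 < e" "\<And>x. x \<in> A \<Longrightarrow> \<exists>U\<in>\<U>. ball x e \<subseteq> G U"
  proof (rule Heine_Borel_lemma[OF assms(1), of "G ` \<U>"])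
    show "A \<subseteq> \<Union>(G ` \<U>)" using G(2) cov by blast
  qed (use G(1) in auto)
  obtain \<V> where V: "finite \<V>" "\<forall>V\<in>\<V>. openin (top_of_set A) (A \<inter> V)" "A \<subseteq> \<Union>\<V>"
    "\<forall>V\<in>\<V>. \<forall>x\<in>V. \<forall>y\<in>V. dist x y < e" "\<forall>x\<in>A. int (card {V\<in>\<V>. x \<in> V}) \<le> n + 1"
    using small[OF e(1)] by blast
  \<comment> \<open>Sets missing \<open>A\<close> are discarded, because the refinement argument
    takes a point of \<open>A \<inter> V\<close> as centre of a ball.\<close>
  define \<W> where "\<W> = (\<inter>) A ` {V\<in>\<V>. A \<inter> V \<noteq> {}}"
  have "\<exists>U\<in>\<U>. A \<inter> V \<subseteq> U" if V': "V \<in> \<V>" "x \<in> A \<inter> V" for V x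
  proof -
    obtain U where U: "U \<in> \<U>" "ball x e \<subseteq> G U" using e(2)[of x] V' by auto
    have "V \<subseteq> ball x e" using V' V(4) by auto
    then have "A \<inter> V \<subseteq> U" using U G(2)[OF U(1)] by blast
    then show ?thesis using U by blast
  qed
  then have "\<forall>W\<in>\<W>. \<exists>U\<in>\<U>. W \<subseteq> U"
    unfolding \<W>_def by blast
  moreover have "int (card {W\<in>\<W>. x \<in> W}) \<le> n + 1" if x: "x \<in> A" for x
  proof -
    have "card {W\<in>\<W>. x \<in> W} \<le> card ((\<inter>) A ` {V\<in>\<V>. x \<in> V})"
      by (intro card_mono) (use V(1) in \<open>auto simp: \<W>_def\<close>)
    also have "\<dots> \<le> card {V\<in>\<V>. x \<in> V}"
      by (intro card_image_le) (use V(1) in auto)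
    finally show ?thesis using V(5) x by fastforce
  qed
  moreover have "finite \<W>" "\<forall>W\<in>\<W>. openin (top_of_set A) W"
    using V(1,2) unfolding \<W>_def by auto
  moreover have "\<Union>\<W> = A"
    using V(3) unfolding \<W>_def by blast
  ultimately show "\<exists>\<V>. finite \<V> \<and> (\<forall>V\<in>\<V>. openin (top_of_set A) V) \<and> \<Union>\<V> = A \<and>
      (\<forall>V\<in>\<V>. \<exists>U\<in>\<U>. V \<subseteq> U) \<and> (\<forall>x\<in>A. int (card {V\<in>\<V>. x \<in> V}) \<le> n + 1)"
    by blast
qed

text \<open>Refine a finite cover by balls of radius \<open>e/2\<close>; two points of such a ball
  are at distance less than \<open>e\<close>.\<close>

lemma compact_cover_dim_leD:
  fixes X :: "'a::metric_space set"
  assumes "compact X" "cover_dim_le (top_of_set X) n" "e > 0"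
  shows "\<exists>\<V>. finite \<V> \<and> (\<forall>V\<in>\<V>. openin (top_of_set X) V) \<and> \<Union>\<V> = X \<and>
    (\<forall>V\<in>\<V>. \<forall>x\<in>V. \<forall>y\<in>V. dist x y < e) \<and> (\<forall>x\<in>X. int (card {V\<in>\<V>. x \<in> V}) \<le> n + 1)"
proof -
  obtain F where F: "finite F" "F \<subseteq> X" "X \<subseteq> (\<Union>x\<in>F. ball x (e/2))"
    using compactE_image[OF assms(1), of X "\<lambda>x. ball x (e/2)"] assms(3)
    by (metis UN_I centre_in_ball half_gt_zero open_ball subsetI)
  let ?U = "(\<lambda>x. X \<inter> ball x (e/2)) ` F"
  have "finite ?U" "\<forall>U\<in>?U. openin (top_of_set X) U" "\<Union>?U = X"
    using F by (auto simp: openin_open_Int)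
  then obtain \<V> where V: "finite \<V>" "\<forall>V\<in>\<V>. openin (top_of_set X) V" "\<Union>\<V> = X"
    "\<forall>V\<in>\<V>. \<exists>U\<in>?U. V \<subseteq> U" "\<forall>x\<in>X. int (card {V\<in>\<V>. x \<in> V}) \<le> n + 1"
    using assms(2) unfolding cover_dim_le_def topspace_euclidean_subtopology
    by (elim allE[of _ ?U] impE exE conjE) simp_all
  have "dist x y < e" if xy: "V \<in> \<V>" "x \<in> V" "y \<in> V" for V x y
  proof -
    obtain z where "V \<subseteq> ball z (e/2)" using V(4) xy by blast
    then have "dist z x < e/2" "dist z y < e/2" using xy by auto
    then show ?thesis by (metis dist_commute dist_triangle_half_l)
  qed
  then show ?thesis using V by (intro exI[of _ \<V>]) auto
qed

section \<open>Generic coefficients and approximation\<close>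

text \<open>The second conclusion says that any at most \<open>card S\<close> columns of the matrix
  \<open>h\<close> are linearly independent. Rows are added one at a time: for each possible support
  of a relation among the old rows, the new row must avoid one further equation, and there are only
  finitely many supports.\<close>

lemma exists_generic_coefficients:
  fixes a :: "'i \<Rightarrow> 'v \<Rightarrow> real"
  assumes "finite S" and "finite \<V>" and "e > 0"
  shows "\<exists>h. (\<forall>i\<in>S. \<forall>v\<in>\<V>. \<bar>h i v - a i v\<bar> < e) \<and>
    (\<forall>c. (\<forall>i\<in>S. (\<Sum>v\<in>\<V>. c v * h i v) = 0) \<longrightarrow> card {v\<in>\<V>. c v \<noteq> 0} \<le> card S \<longrightarrow> (\<forall>v\<in>\<V>. c v = 0))"
  using assms(1)
proof (induction S)
  case empty
  show ?case using \<open>finite \<V>\<close> by auto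
next
  case (insert j S)
  then obtain h where h: "\<And>i v. i \<in> S \<Longrightarrow> v \<in> \<V> \<Longrightarrow> \<bar>h i v - a i v\<bar> < e"
    and ind: "\<And>c. \<forall>i\<in>S. (\<Sum>v\<in>\<V>. c v * h i v) = 0 \<Longrightarrow> card {v\<in>\<V>. c v \<noteq> 0} \<le> card S
      \<Longrightarrow> \<forall>v\<in>\<V>. c v = 0"
    by auto
  define R where "R \<sigma> c \<longleftrightarrow> (\<forall>i\<in>S. (\<Sum>v\<in>\<V>. c v * h i v) = 0) \<and> {v\<in>\<V>. c v \<noteq> 0} = \<sigma>" for \<sigma> and c :: "'v \<Rightarrow> real"
  \<comment> \<open>One representative relation per support \<open>\<sigma>\<close>; the choice is
    arbitrary if none exists, so \<open>P\<close> keeps only those \<open>\<sigma>\<close> where it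
    is genuine.\<close>
  define C where "C \<sigma> = (SOME c. R \<sigma> c)" for \<sigma>
  define P where "P = {\<sigma>. \<sigma> \<subseteq> \<V> \<and> \<sigma> \<noteq> {} \<and> R \<sigma> (C \<sigma>)}"
  have "finite P" using \<open>finite \<V>\<close> by (auto simp: P_def intro: finite_subset[of _ "Pow \<V>"])
  obtain num :: "'v \<Rightarrow> nat" where num: "inj_on num \<V>"
    using \<open>finite \<V>\<close> finite_imp_inj_to_nat_seg by blast
  \<comment> \<open>Perturbing \<open>a j v\<close> by \<open>t ^ Suc (num v)\<close> turns each forbidden relation into a nonzero polynomial equation in \<open>t\<close>.\<close>
  define p where "p \<sigma> = [:\<Sum>v\<in>\<V>. C \<sigma> v * a j v:] + (\<Sum>v\<in>\<V>. monom (C \<sigma> v) (Suc (num v)))" for \<sigma>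
  have peval: "poly (p \<sigma>) t = (\<Sum>v\<in>\<V>. C \<sigma> v * (a j v + t ^ Suc (num v)))" for \<sigma> t
    by (simp add: p_def poly_sum poly_monom distrib_left sum.distrib)
  have "p \<sigma> \<noteq> 0" if \<sigma>: "\<sigma> \<in> P" for \<sigma>
  proof -
    obtain w where w: "w \<in> \<V>" "C \<sigma> w \<noteq> 0"
      using \<sigma> unfolding P_def R_def by blast
    \<comment> \<open>The exponents are distinct and positive, so neither the other monomials nor
      the constant term contribute here.\<close>
    have "coeff (p \<sigma>) (Suc (num w)) = (\<Sum>v\<in>\<V>. if v = w then C \<sigma> v else 0)"
      unfolding p_def using num w by (auto simp: coeff_sum inj_on_def intro!: sum.cong)
    also have "\<dots> = C \<sigma> w" using w \<open>finite \<V>\<close> by simp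
    finally show ?thesis using w by auto
  qed
  then have "finite (\<Union>\<sigma>\<in>P. {t. poly (p \<sigma>) t = 0})"
    using \<open>finite P\<close> poly_roots_finite by blast
  then have "infinite ({0<..<min e 1} - (\<Union>\<sigma>\<in>P. {t. poly (p \<sigma>) t = 0}))"
    using \<open>e > 0\<close> by (intro Diff_infinite_finite) (auto simp: infinite_Ioo)
  then obtain t where "t \<in> {0<..<min e 1} - (\<Union>\<sigma>\<in>P. {t. poly (p \<sigma>) t = 0})"
    by (metis all_not_in_conv finite.emptyI)
  then have t: "0 < t" "t < e" "t < 1" "\<forall>\<sigma>\<in>P. poly (p \<sigma>) t \<noteq> 0"
    by auto
  define h' where "h' i v = (if i = j then a j v + t ^ Suc (num v) else h i v)" for i v
  have close: "\<bar>h' i v - a i v\<bar> < e" if "i \<in> insert j S" "v \<in> \<V>" for i v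
  proof (cases "i = j")
    case True
    have "t ^ Suc (num v) \<le> t" using t by (simp add: mult_left_le power_le_one)
    then show ?thesis using t(1,2) True by (simp add: h'_def abs_mult del: power_Suc)
  next
    case False
    then show ?thesis using h that by (auto simp: h'_def)
  qed
  have "\<forall>v\<in>\<V>. c v = 0" if rel: "\<forall>i\<in>insert j S. (\<Sum>v\<in>\<V>. c v * h' i v) = 0"
    and card: "card {v\<in>\<V>. c v \<noteq> 0} \<le> card (insert j S)" for c
  proof (rule ccontr)
    assume neg: "\<not> (\<forall>v\<in>\<V>. c v = 0)"
    define \<sigma> where "\<sigma> = {v\<in>\<V>. c v \<noteq> 0}"
    have relS: "\<And>i. i \<in> S \<Longrightarrow> (\<Sum>v\<in>\<V>. c v * h i v) = 0"
    proof -
      fix i assume "i \<in> S"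
      then have "(\<Sum>v\<in>\<V>. c v * h' i v) = 0" "i \<noteq> j" using rel insert(2) by auto
      then show "(\<Sum>v\<in>\<V>. c v * h i v) = 0" by (simp add: h'_def)
    qed
    have "R \<sigma> c" using relS by (auto simp: R_def \<sigma>_def)
    then have RC: "R \<sigma> (C \<sigma>)" unfolding C_def by (metis someI)
    then have \<sigma>P: "\<sigma> \<in> P" using neg by (auto simp: P_def \<sigma>_def)
    obtain w where w: "w \<in> \<V>" "c w \<noteq> 0" using neg by blast
    then have Cw: "C \<sigma> w \<noteq> 0" using RC unfolding R_def \<sigma>_def by blast
    \<comment> \<open>Cancelling the coefficient at w leaves a relation of smaller support, so all relations with support \<open>\<sigma>\<close> are proportional.\<close>
    define q where "q = c w / C \<sigma> w"
    define c' where "c' v = c v - q * C \<sigma> v" for v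
    have "(\<Sum>v\<in>\<V>. c' v * h i v) = 0" if "i \<in> S" for i
    proof -
      have "(\<Sum>v\<in>\<V>. c' v * h i v) = (\<Sum>v\<in>\<V>. c v * h i v) - q * (\<Sum>v\<in>\<V>. C \<sigma> v * h i v)"
        by (simp add: c'_def sum_subtractf sum_distrib_left algebra_simps)
      then show ?thesis using relS[OF that] RC that by (simp add: R_def)
    qed
    moreover have "card {v\<in>\<V>. c' v \<noteq> 0} \<le> card S"
    proof -
      have "{v\<in>\<V>. c' v \<noteq> 0} \<subseteq> \<sigma> - {w}"
        using RC Cw by (auto simp: c'_def q_def R_def \<sigma>_def)
      then have "card {v\<in>\<V>. c' v \<noteq> 0} \<le> card (\<sigma> - {w})"
        using \<open>finite \<V>\<close> by (intro card_mono) (auto simp: \<sigma>_def)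
      also have "\<dots> = card \<sigma> - 1"
        using w \<open>finite \<V>\<close> by (subst card_Diff_singleton) (auto simp: \<sigma>_def)
      finally show ?thesis using card insert(1,2) unfolding \<sigma>_def by simp
    qed
    ultimately have "\<And>v. v \<in> \<V> \<Longrightarrow> c' v = 0" using ind by blast
    then have cq: "c v = q * C \<sigma> v" if "v \<in> \<V>" for v
      using that by (force simp: c'_def)
    have "(\<Sum>v\<in>\<V>. c v * h' j v) = q * poly (p \<sigma>) t"
      unfolding peval sum_distrib_left by (rule sum.cong) (auto simp: h'_def cq)
    then have "q * poly (p \<sigma>) t = 0" using rel by simp
    moreover have "q \<noteq> 0" using w Cw by (simp add: q_def)
    ultimately show False using t(4) \<sigma>P by simp
  qed
  then show ?case using close by (intro exI[of _ h']) blast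
qed

text \<open>Baire's argument with nested closed balls in the sup norm: the ball chosen at stage
  \<open>n\<close> forces \<open>P n\<close>, the radii tend to zero, and the uniform limit of the
  centres lies in all the balls. Because \<open>P n\<close> is assumed for all \<open>h\<close> near
  \<open>g\<close>, continuous or not, it can be read off at the limit.\<close>

lemma exists_approximation_satisfying_countably_many:
  fixes X :: "'a::topological_space set" and P :: "nat \<Rightarrow> ('a \<Rightarrow> real) \<Rightarrow> bool"
  assumes dense: "\<And>n f e. continuous_on X f \<Longrightarrow> e > 0 \<Longrightarrow>
      \<exists>g. continuous_on X g \<and> (\<forall>x\<in>X. \<bar>g x - f x\<bar> \<le> e) \<and>
        (\<exists>r>0. \<forall>h. (\<forall>x\<in>X. \<bar>h x - g x\<bar> \<le> r) \<longrightarrow> P n h)"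
    and f: "continuous_on X f" and e: "e > 0"
  obtains g where "continuous_on X g" "\<And>x. x \<in> X \<Longrightarrow> \<bar>g x - f x\<bar> \<le> e" "\<And>n. P n g"
proof -
  \<comment> \<open>A state is a closed ball, given by its centre \<open>fst s\<close> and radius
    \<open>snd s\<close>.\<close>
  define I where "I n s \<longleftrightarrow> continuous_on X (fst s) \<and> 0 < snd s \<and> snd s \<le> (1/2)^n"
    for n :: nat and s :: "('a \<Rightarrow> real) \<times> real"
  \<comment> \<open>The first condition puts the new closed ball inside the old one; the last makes
    \<open>P n\<close> hold throughout the new ball.\<close>
  define Q where "Q n s s' \<longleftrightarrow> (\<forall>x\<in>X. \<bar>fst s' x - fst s x\<bar> + snd s' \<le> snd s) \<and> snd s' \<le> snd s \<and>
      (\<forall>h. (\<forall>x\<in>X. \<bar>h x - fst s' x\<bar> \<le> snd s') \<longrightarrow> P n h)"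
    for n and s s' :: "('a \<Rightarrow> real) \<times> real"
  have step: "\<exists>s'. I (Suc n) s' \<and> Q n s s'" if s: "I n s" for n s
  proof -
    obtain g r where g: "continuous_on X g" "\<forall>x\<in>X. \<bar>g x - fst s x\<bar> \<le> snd s / 2" "r > 0"
      "\<forall>h. (\<forall>x\<in>X. \<bar>h x - g x\<bar> \<le> r) \<longrightarrow> P n h"
      using dense[of "fst s" "snd s / 2" n] s unfolding I_def by auto
    \<comment> \<open>Half of the old radius is spent on moving the centre and at most half on the
      new radius, which gives both nesting and geometric decay.\<close>
    define m where "m = min r (snd s / 2)"
    have m: "0 < m" "m \<le> r" "m \<le> snd s / 2"
      using g s by (auto simp: m_def I_def)
    have "I (Suc n) (g, m)"
      using g(1) s m by (auto simp: I_def)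
    moreover have "Q n s (g, m)"
      unfolding Q_def fst_conv snd_conv
    proof (intro conjI allI impI ballI)
      show "\<bar>g x - fst s x\<bar> + m \<le> snd s" if "x \<in> X" for x
        using g(2) m that by fastforce
      show "m \<le> snd s" using m by linarith
      show "P n h" if "\<forall>x\<in>X. \<bar>h x - g x\<bar> \<le> m" for h
        using g(4) m(2) that by (meson order_trans)
    qed
    ultimately show ?thesis by blast
  qed
  \<comment> \<open>This pins the initial ball: radius at most \<open>e\<close> controls the final
    error, and radius at most 1 meets the bound \<open>(1/2)^0\<close>.\<close>
  define I' where "I' n s \<longleftrightarrow> I n s \<and> (n = 0 \<longrightarrow> s = (f, min e 1))" for n s
  have "\<exists>s. \<forall>n. I' n (s n) \<and> Q n (s n) (s (Suc n))"
  proof (rule dependent_nat_choice)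
    show "\<exists>s. I' 0 s" using f e by (auto simp: I'_def I_def)
    show "\<And>s n. I' n s \<Longrightarrow> \<exists>s'. I' (Suc n) s' \<and> Q n s s'"
      using step by (auto simp: I'_def)
  qed
  then obtain s where s: "\<And>n. I' n (s n)" "\<And>n. Q n (s n) (s (Suc n))" by blast
  define u where "u n = fst (s n)" for n
  define r where "r n = snd (s n)" for n
  have u0: "u 0 = f" "r 0 \<le> e" using s(1)[of 0] by (auto simp: I'_def u_def r_def)
  have cont: "continuous_on X (u n)" and rn: "0 < r n" "r n \<le> (1/2)^n" for n
    using s(1)[of n] by (auto simp: I'_def I_def u_def r_def)
  have us: "\<bar>u (Suc n) x - u n x\<bar> + r (Suc n) \<le> r n" if "x \<in> X" for n x
    using s(2)[of n] that by (auto simp: Q_def u_def r_def)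
  have Pn: "P n h" if "\<forall>x\<in>X. \<bar>h x - u (Suc n) x\<bar> \<le> r (Suc n)" for n h
    using s(2)[of n] that by (auto simp: Q_def u_def r_def)
  have nest: "\<bar>u (n + m) x - u n x\<bar> + r (n + m) \<le> r n" if x: "x \<in> X" for n m x
  proof (induction m)
    case (Suc m)
    then show ?case using us[OF x, of "n + m"] by simp
  qed simp
  then have near: "\<bar>u m x - u n x\<bar> \<le> r n" if "x \<in> X" "n \<le> m" for n m x
    using nest[OF that(1), of n "m - n"] that(2) rn(1)[of m] by simp
  have pointwise: "\<exists>l. (\<lambda>n. u n x) \<longlonglongrightarrow> l" if x: "x \<in> X" for x
  proof -
    have "Cauchy (\<lambda>n. u n x)"
    proof (rule metric_CauchyI)
      fix e :: real assume "0 < e"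
      then obtain N where N: "(1/2::real)^N < e/2"
        using real_arch_pow_inv[of "e/2" "1/2"] by auto
      have "dist (u m x) (u n x) < e" if "m \<ge> N" "n \<ge> N" for m n
        using near[OF x that(1)] near[OF x that(2)] rn(2)[of N] N by (simp add: dist_real_def)
      then show "\<exists>M. \<forall>m\<ge>M. \<forall>n\<ge>M. dist (u m x) (u n x) < e" by blast
    qed
    then show ?thesis using convergent_def real_Cauchy_convergent by blast
  qed
  then obtain g where g: "\<And>x. x \<in> X \<Longrightarrow> (\<lambda>n. u n x) \<longlonglongrightarrow> g x" by metis
  have gn: "\<bar>g x - u n x\<bar> \<le> r n" if x: "x \<in> X" for n x
  proof (rule Lim_bounded)
    show "(\<lambda>m. \<bar>u m x - u n x\<bar>) \<longlonglongrightarrow> \<bar>g x - u n x\<bar>"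
      by (intro tendsto_intros g x)
    show "\<forall>m\<ge>n. \<bar>u m x - u n x\<bar> \<le> r n" using near[OF x] by blast
  qed
  have "uniform_limit X u g sequentially"
  proof (rule uniform_limitI)
    fix e :: real assume "0 < e"
    then obtain N where N: "(1/2::real)^N < e"
      using real_arch_pow_inv[of e "1/2"] by auto
    have "dist (u n x) (g x) < e" if "n \<ge> N" "x \<in> X" for n x
    proof -
      have "(1/2::real)^n \<le> (1/2)^N" using that by (intro power_decreasing) auto
      then show ?thesis using gn[OF that(2), of n] rn(2)[of n] N unfolding dist_real_def by linarith
    qed
    then show "\<forall>\<^sub>F n in sequentially. \<forall>x\<in>X. dist (u n x) (g x) < e"
      unfolding eventually_sequentially by blast
  qed
  then have "continuous_on X g"
    using cont by (intro uniform_limit_theorem) auto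
  moreover have "\<bar>g x - f x\<bar> \<le> e" if "x \<in> X" for x
    using gn[OF that, of 0] u0 by auto
  moreover have "P n g" for n using Pn gn by blast
  ultimately show thesis using that by blast
qed

section \<open>Fine covers of fibres\<close>

lemma finite_partition_of_unity:
  fixes X :: "'a::metric_space set"
  assumes "finite \<V>" "\<forall>V\<in>\<V>. openin (top_of_set X) V" "\<Union>\<V> = X"
  obtains \<phi> :: "'a set \<Rightarrow> 'a \<Rightarrow> real" where "\<forall>V\<in>\<V>. continuous_on X (\<phi> V)"
    "\<forall>V\<in>\<V>. \<forall>x\<in>X. 0 \<le> \<phi> V x" "\<forall>V\<in>\<V>. \<forall>x\<in>X. x \<notin> V \<longrightarrow> \<phi> V x = 0"
    "\<forall>x\<in>X. (\<Sum>V\<in>\<V>. \<phi> V x) = 1"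
proof -
  have "\<forall>V\<in>\<V>. \<exists>G. open G \<and> V = X \<inter> G" using assms(2) by (auto simp: openin_open)
  then obtain G where G: "\<forall>V\<in>\<V>. open (G V) \<and> V = X \<inter> G V" by metis
  \<comment> \<open>Injectivity allows passing from the sum over the ambient open sets
    \<open>G V\<close> back to the sum over \<open>\<V>\<close>.\<close>
  then have inj: "inj_on G \<V>" by (metis inj_onI)
  have sub: "X \<subseteq> \<Union>(G ` \<V>)" using G assms(3) by blast
  have opn: "\<And>B. B \<in> G ` \<V> \<Longrightarrow> open B" using G by auto
  have lf: "\<exists>N. open N \<and> x \<in> N \<and> finite {U \<in> G ` \<V>. U \<inter> N \<noteq> {}}" if "x \<in> X" for x
    using assms(1) by (intro exI[of _ UNIV]) auto
  obtain F :: "'a set \<Rightarrow> 'a \<Rightarrow> real"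
    where F: "\<forall>V\<in>\<V>. continuous_on X (F (G V)) \<and> (\<forall>x\<in>X. 0 \<le> F (G V) x)"
      "\<forall>V\<in>\<V>. \<forall>x\<in>X. x \<notin> G V \<longrightarrow> F (G V) x = 0"
      "\<forall>x\<in>X. supp_sum (\<lambda>W. F W x) (G ` \<V>) = 1"
  proof (rule subordinate_partition_of_unity[of X "G ` \<V>"])
    fix F :: "'a set \<Rightarrow> 'a \<Rightarrow> real"
    assume "\<And>U. U \<in> G ` \<V> \<Longrightarrow> continuous_on X (F U) \<and> (\<forall>x\<in>X. 0 \<le> F U x)"
      "\<And>x U. U \<in> G ` \<V> \<Longrightarrow> x \<in> X \<Longrightarrow> x \<notin> U \<Longrightarrow> F U x = 0"
      "\<And>x. x \<in> X \<Longrightarrow> supp_sum (\<lambda>W. F W x) (G ` \<V>) = 1"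
    then show thesis by (intro that[of F]) auto
  qed (use sub opn lf in auto)
  have "(\<Sum>V\<in>\<V>. F (G V) x) = 1" if x: "x \<in> X" for x
  proof -
    have "supp_sum (\<lambda>W. F W x) (G ` \<V>) = (\<Sum>W\<in>G ` \<V>. F W x)"
      unfolding supp_sum_def support_on_def using assms(1) by (intro sum.mono_neutral_left) auto
    then show ?thesis using F(3) x by (simp add: sum.reindex[OF inj])
  qed
  moreover have "\<forall>V\<in>\<V>. \<forall>x\<in>X. x \<notin> V \<longrightarrow> F (G V) x = 0"
    using F(2) G by blast
  ultimately show thesis
    using F(1) by (intro that[of "\<lambda>V. F (G V)"]) auto
qed

text \<open>The members are open in \<open>X\<close> and the order is bounded on all of
  \<open>X\<close>, so one family can serve the fibres of all nearby functions. The bound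
  \<open>c\<close> is one more than a dimension; \<open>c = 0\<close> forces \<open>A\<close> to be
  empty.\<close>

definition fine_cover :: "'a::metric_space set \<Rightarrow> nat \<Rightarrow> real \<Rightarrow> 'a set \<Rightarrow> bool" where
  "fine_cover X c e A \<longleftrightarrow> (\<exists>\<G>. finite \<G> \<and> (\<forall>G\<in>\<G>. openin (top_of_set X) G) \<and>
     (\<forall>G\<in>\<G>. \<forall>x\<in>G. \<forall>y\<in>G. dist x y < e) \<and> (\<forall>x\<in>X. card {G\<in>\<G>. x \<in> G} \<le> c) \<and> A \<subseteq> \<Union>\<G>)"

lemma fine_cover_mono:
  "fine_cover X c e A \<Longrightarrow> B \<subseteq> A \<Longrightarrow> fine_cover X c e B"
  unfolding fine_cover_def by (meson order_trans)

lemma cover_dim_le_if_fine_covers: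
  assumes "compact A" "A \<subseteq> X" "\<And>e. e > 0 \<Longrightarrow> fine_cover X c e A"
  shows "cover_dim_le (top_of_set A) (int c - 1)"
proof (rule compact_cover_dim_leI[OF assms(1)])
  fix e :: real assume "e > 0"
  from assms(3)[OF this] obtain \<G> where G: "finite \<G>" "\<forall>G\<in>\<G>. openin (top_of_set X) G"
     "\<forall>G\<in>\<G>. \<forall>x\<in>G. \<forall>y\<in>G. dist x y < e" "\<forall>x\<in>X. card {G\<in>\<G>. x \<in> G} \<le> c" "A \<subseteq> \<Union>\<G>"
    unfolding fine_cover_def by blast
  have "openin (top_of_set A) (A \<inter> G)" if "G \<in> \<G>" for G
    using G(2) that assms(2) by (metis openin_subtopology_Int2 subtopology_subtopology inf.absorb_iff2)
  moreover have "int (card {G\<in>\<G>. x \<in> G}) \<le> int c - 1 + 1" if "x \<in> A" for x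
    using G(4) that assms(2) by auto
  ultimately show "\<exists>\<V>. finite \<V> \<and> (\<forall>V\<in>\<V>. openin (top_of_set A) (A \<inter> V)) \<and> A \<subseteq> \<Union>\<V> \<and>
      (\<forall>V\<in>\<V>. \<forall>x\<in>V. \<forall>y\<in>V. dist x y < e) \<and> (\<forall>x\<in>A. int (card {V\<in>\<V>. x \<in> V}) \<le> int c - 1 + 1)"
    using G(1,3,5) by blast
qed

text \<open>For weights of sum 1, the sets \<open>G \<sigma>\<close> are the preimages, in the nerve
  of \<open>\<V>\<close>, of the open stars of barycentres in the barycentric subdivision. Points
  with more than \<open>m\<close> nonzero weights are reached by faces with more than
  \<open>m\<close> vertices, and omitting the smaller faces lowers the order by
  \<open>m\<close>.\<close>

lemma fine_cover_where_many_weights: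
  fixes X :: "'a::metric_space set" and \<phi> :: "'a set \<Rightarrow> 'a \<Rightarrow> real"
  assumes fin: "finite \<V>" and small: "\<forall>V\<in>\<V>. \<forall>x\<in>V. \<forall>y\<in>V. dist x y < e"
    and ord: "\<forall>x\<in>X. card {V\<in>\<V>. x \<in> V} \<le> n + 1"
    and cont: "\<forall>V\<in>\<V>. continuous_on X (\<phi> V)" and nonneg: "\<forall>V\<in>\<V>. \<forall>x\<in>X. 0 \<le> \<phi> V x"
    and supp: "\<forall>V\<in>\<V>. \<forall>x\<in>X. x \<notin> V \<longrightarrow> \<phi> V x = 0"
  shows "fine_cover X (n + 1 - m) e {x\<in>X. m < card {V\<in>\<V>. \<phi> V x \<noteq> 0}}"
proof -
  \<comment> \<open>Sets \<open>G \<sigma>\<close> with distinct \<open>\<sigma>\<close> of equal size are disjoint, so the order is at most the number of sizes.\<close>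
  define G where "G \<sigma> = {x\<in>X. (\<forall>v\<in>\<sigma>. 0 < \<phi> v x) \<and> (\<forall>v\<in>\<sigma>. \<forall>w\<in>\<V>-\<sigma>. \<phi> w x < \<phi> v x)}" for \<sigma>
  \<comment> \<open>There are \<open>n + 1 - m\<close> admissible sizes; with truncated subtraction
    this is 0 when \<open>m > n\<close>, and then \<open>\<Sigma>\<close> is empty.\<close>
  define \<Sigma> where "\<Sigma> = {\<sigma>. \<sigma> \<subseteq> \<V> \<and> card \<sigma> \<in> {m+1..n+1}}"
  have finS: "finite \<Sigma>" using fin by (auto simp: \<Sigma>_def)
  have opG: "openin (top_of_set X) (G \<sigma>)" if "\<sigma> \<in> \<Sigma>" for \<sigma>
  proof -
    have s: "\<sigma> \<subseteq> \<V>" "finite \<sigma>" "finite (\<V> - \<sigma>)"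
      using that fin by (auto simp: \<Sigma>_def intro: finite_subset)
    have 1: "openin (top_of_set X) {x\<in>X. 0 < \<phi> v x}" if "v \<in> \<V>" for v
      using cont that continuous_openin_preimage_gen[of X "\<phi> v" "{0<..}"]
      by (simp add: vimage_def Collect_conj_eq[symmetric] Int_def)
    have 2: "openin (top_of_set X) {x\<in>X. \<phi> w x < \<phi> v x}" if "v \<in> \<V>" "w \<in> \<V>" for v w
      using cont that continuous_openin_preimage_gen[of X "\<lambda>x. \<phi> v x - \<phi> w x" "{0<..}"]
      by (simp add: vimage_def Int_def continuous_on_diff)
    have fin_Int: "openin (top_of_set X) (X \<inter> (\<Inter>i\<in>I. C i))"
      if "finite I" "\<And>i. i \<in> I \<Longrightarrow> openin (top_of_set X) (C i)" for I and C :: "'a set \<Rightarrow> 'a set"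
      using that by (induction I) (auto simp: Int_left_commute[of X])
    have "G \<sigma> = (X \<inter> (\<Inter>v\<in>\<sigma>. {x\<in>X. 0 < \<phi> v x})) \<inter> (X \<inter> (\<Inter>v\<in>\<sigma>. X \<inter> (\<Inter>w\<in>\<V>-\<sigma>. {x\<in>X. \<phi> w x < \<phi> v x})))"
      by (auto simp: G_def)
    also have "openin (top_of_set X) \<dots>"
      by (intro openin_Int fin_Int) (use s 1 2 in auto)
    finally show ?thesis .
  qed
  have small': "dist x y < e" if \<sigma>: "\<sigma> \<in> \<Sigma>" "x \<in> G \<sigma>" "y \<in> G \<sigma>" for \<sigma> x y
  proof -
    have "\<sigma> \<noteq> {}" using that(1) by (auto simp: \<Sigma>_def)
    then obtain v where v: "v \<in> \<sigma>" "v \<in> \<V>" using \<sigma>(1) unfolding \<Sigma>_def by blast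
    then have "0 < \<phi> v x" "0 < \<phi> v y" "x \<in> X" "y \<in> X" using that by (auto simp: G_def)
    then have "x \<in> v" "y \<in> v" using supp v by force+
    then show ?thesis using small v by blast
  qed
  have ord': "card {A \<in> G ` \<Sigma>. x \<in> A} \<le> n + 1 - m" for x
  proof -
    let ?S = "{\<sigma>\<in>\<Sigma>. x \<in> G \<sigma>}"
    have "inj_on card ?S"
    proof (rule inj_onI)
      fix \<sigma> \<tau> assume a: "\<sigma> \<in> ?S" "\<tau> \<in> ?S" "card \<sigma> = card \<tau>"
      have f: "finite \<sigma>" "finite \<tau>" using a fin by (auto simp: \<Sigma>_def intro: finite_subset)
      show "\<sigma> = \<tau>"
      proof (rule ccontr)
        assume ne: "\<sigma> \<noteq> \<tau>"
        \<comment> \<open>Distinct sets of equal size each contain an element missing from the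
          other, and each of these two weights would have to exceed the other.\<close>
        have "\<not> \<sigma> \<subseteq> \<tau>" "\<not> \<tau> \<subseteq> \<sigma>"
          using ne a(3) f card_subset_eq by metis+
        then obtain v w where vw: "v \<in> \<sigma>" "v \<notin> \<tau>" "w \<in> \<tau>" "w \<notin> \<sigma>" by blast
        then have "\<phi> w x < \<phi> v x" "\<phi> v x < \<phi> w x"
          using a by (auto simp: G_def \<Sigma>_def subset_iff)
        then show False by simp
      qed
    qed
    then have "card ?S = card (card ` ?S)" by (simp add: card_image)
    also have "\<dots> \<le> card {m+1..n+1}" by (intro card_mono) (auto simp: \<Sigma>_def)
    finally have "card ?S \<le> n + 1 - m" by simp
    moreover have "card {A \<in> G ` \<Sigma>. x \<in> A} \<le> card ?S"
      using finS by (intro surj_card_le[of _ _ G]) auto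
    ultimately show ?thesis by linarith
  qed
  have cov: "{x\<in>X. m < card {V\<in>\<V>. \<phi> V x \<noteq> 0}} \<subseteq> \<Union>(G ` \<Sigma>)"
  proof
    fix x assume "x \<in> {x\<in>X. m < card {V\<in>\<V>. \<phi> V x \<noteq> 0}}"
    then have x: "x \<in> X" "m < card {V\<in>\<V>. \<phi> V x \<noteq> 0}" by auto
    let ?\<sigma> = "{V\<in>\<V>. \<phi> V x \<noteq> 0}"
    have "card ?\<sigma> \<le> card {V\<in>\<V>. x \<in> V}"
      using fin supp x by (intro card_mono) auto
    then have "card ?\<sigma> \<le> n + 1" using ord x by fastforce
    then have "?\<sigma> \<in> \<Sigma>" using x by (auto simp: \<Sigma>_def)
    moreover have "x \<in> G ?\<sigma>" using x nonneg by (force simp: G_def less_le)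
    ultimately show "x \<in> \<Union>(G ` \<Sigma>)" by blast
  qed
  show ?thesis
    unfolding fine_cover_def
    using finS opG small' ord' cov by (intro exI[of _ "G ` \<Sigma>"]) simp
qed

text \<open>Each \<open>g i\<close> interpolates perturbed sample values of \<open>F i\<close> by a
  partition of unity. At a common zero the weights form a nontrivial relation among generic
  coefficients, so more than \<open>card S\<close> weights are nonzero.\<close>

lemma exists_approximation_with_fine_fibre:
  fixes X K :: "'a::metric_space set" and F :: "'i \<Rightarrow> 'a \<Rightarrow> real"
  assumes X: "compact X" "cover_dim_le (top_of_set X) (int n)" and K: "compact K" "K \<subseteq> X"
    and S: "finite S" and F: "\<forall>i\<in>S. continuous_on K (F i)" and "e > 0" "\<eta> > 0"
  obtains g where "\<forall>i\<in>S. continuous_on K (g i)" "\<forall>i\<in>S. \<forall>x\<in>K. \<bar>g i x - F i x\<bar> \<le> e"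
    "fine_cover X (n + 1 - card S) \<eta> {x\<in>K. \<forall>i\<in>S. g i x = 0}"
proof -
  have "\<exists>r>0. \<forall>x\<in>K. \<forall>y\<in>K. dist y x < r \<longrightarrow> dist (F i y) (F i x) < e/2" if "i \<in> S" for i
    using compact_uniformly_continuous[OF bspec[OF F that] K(1)] \<open>e > 0\<close>
    unfolding uniformly_continuous_on_def by (meson half_gt_zero)
  then obtain r where r: "\<forall>i\<in>S. r i > 0 \<and> (\<forall>x\<in>K. \<forall>y\<in>K. dist y x < r i \<longrightarrow> dist (F i y) (F i x) < e/2)"
    by metis
  \<comment> \<open>A single mesh that is below \<open>\<eta>\<close> and good for the uniform
    continuity of all \<open>F i\<close> at once.\<close>
  define \<delta> where "\<delta> = Min (insert \<eta> (r ` S))"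
  have \<delta>: "0 < \<delta>" "\<delta> \<le> \<eta>" "\<forall>i\<in>S. \<delta> \<le> r i"
    using r S \<open>\<eta> > 0\<close> by (auto simp: \<delta>_def)
  obtain \<V> where V: "finite \<V>" "\<forall>V\<in>\<V>. openin (top_of_set X) V" "\<Union>\<V> = X"
    "\<forall>V\<in>\<V>. \<forall>x\<in>V. \<forall>y\<in>V. dist x y < \<delta>" "\<forall>x\<in>X. int (card {V\<in>\<V>. x \<in> V}) \<le> int n + 1"
    using compact_cover_dim_leD[OF X \<delta>(1)] by (elim exE conjE) (rule that)
  obtain \<phi> :: "'a set \<Rightarrow> 'a \<Rightarrow> real" where \<phi>: "\<forall>V\<in>\<V>. continuous_on X (\<phi> V)"
    "\<forall>V\<in>\<V>. \<forall>x\<in>X. 0 \<le> \<phi> V x" "\<forall>V\<in>\<V>. \<forall>x\<in>X. x \<notin> V \<longrightarrow> \<phi> V x = 0"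
    "\<forall>x\<in>X. (\<Sum>V\<in>\<V>. \<phi> V x) = 1"
    by (rule finite_partition_of_unity[OF V(1-3)])
  \<comment> \<open>Sample point of \<open>V\<close> in \<open>K\<close>. If \<open>V\<close> misses
    \<open>K\<close> it is arbitrary, which is harmless since \<open>\<phi> V\<close> then vanishes
    on \<open>K\<close>.\<close>
  define p where "p V = (SOME x. x \<in> V \<inter> K)" for V :: "'a set"
  have p: "p V \<in> V \<inter> K" if "x \<in> V" "x \<in> K" for V x
    unfolding p_def using that by (metis IntI someI)
  obtain h where h: "\<forall>i\<in>S. \<forall>v\<in>\<V>. \<bar>h i v - F i (p v)\<bar> < e/2"
    and gen: "\<forall>c. (\<forall>i\<in>S. (\<Sum>v\<in>\<V>. c v * h i v) = 0) \<longrightarrow> card {v\<in>\<V>. c v \<noteq> 0} \<le> card S \<longrightarrow> (\<forall>v\<in>\<V>. c v = 0)"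
    using exists_generic_coefficients[OF S V(1), of "e/2" "\<lambda>i v. F i (p v)"] \<open>e > 0\<close> by auto
  define g where "g i x = (\<Sum>v\<in>\<V>. \<phi> v x * h i v)" for i x
  have "\<forall>i\<in>S. continuous_on K (g i)"
    unfolding g_def using \<phi>(1) K(2)
    by (auto intro!: continuous_on_sum continuous_on_mult continuous_on_const intro: continuous_on_subset)
  moreover have "\<bar>g i x - F i x\<bar> \<le> e" if i: "i \<in> S" and x: "x \<in> K" for i x
  proof -
    have xX: "x \<in> X" using x K by blast
    have "g i x - F i x = (\<Sum>v\<in>\<V>. \<phi> v x * h i v) - (\<Sum>v\<in>\<V>. \<phi> v x) * F i x"
      using \<phi>(4) xX by (simp add: g_def)
    also have "\<dots> = (\<Sum>v\<in>\<V>. \<phi> v x * (h i v - F i x))"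
      by (simp add: sum_subtractf sum_distrib_right right_diff_distrib)
    also have "\<bar>\<dots>\<bar> \<le> (\<Sum>v\<in>\<V>. \<phi> v x * e)"
    proof (rule order_trans[OF sum_abs], rule sum_mono)
      fix v assume v: "v \<in> \<V>"
      show "\<bar>\<phi> v x * (h i v - F i x)\<bar> \<le> \<phi> v x * e"
      proof (cases "x \<in> v")
        case True
        have pv: "p v \<in> v" "p v \<in> K" using p[OF True x] by auto
        then have "dist (p v) x < r i" using V(4) v pv(1) True \<delta>(3) i by (meson less_le_trans)
        then have "\<bar>F i (p v) - F i x\<bar> < e/2" using r i x pv by (auto simp: dist_real_def)
        moreover have "\<bar>h i v - F i (p v)\<bar> < e/2" using h i v by blast
        ultimately have "\<bar>h i v - F i x\<bar> \<le> e" by linarith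
        then show ?thesis using \<phi>(2) v xX by (simp add: abs_mult mult_left_mono)
      qed (use \<phi>(3) v xX in simp)
    qed
    also have "\<dots> = e" using \<phi>(4) xX by (simp add: sum_distrib_right[symmetric])
    finally show ?thesis .
  qed
  moreover have "fine_cover X (n + 1 - card S) \<eta> {x\<in>K. \<forall>i\<in>S. g i x = 0}"
  proof (rule fine_cover_mono)
    show "fine_cover X (n + 1 - card S) \<eta> {x\<in>X. card S < card {V\<in>\<V>. \<phi> V x \<noteq> 0}}"
    proof (rule fine_cover_where_many_weights[OF V(1) _ _ \<phi>(1-3)])
      show "\<forall>V\<in>\<V>. \<forall>x\<in>V. \<forall>y\<in>V. dist x y < \<eta>" using V(4) \<delta>(2) by fastforce
      show "\<forall>x\<in>X. card {V\<in>\<V>. x \<in> V} \<le> n + 1" using V(5) by fastforce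
    qed
    show "{x\<in>K. \<forall>i\<in>S. g i x = 0} \<subseteq> {x\<in>X. card S < card {V\<in>\<V>. \<phi> V x \<noteq> 0}}"
    proof clarify
      fix x assume x: "x \<in> K" "\<forall>i\<in>S. g i x = 0"
      have xX: "x \<in> X" using x K by blast
      have "\<not> (\<forall>v\<in>\<V>. \<phi> v x = 0)" using \<phi>(4) xX by force
      then have "\<not> card {V\<in>\<V>. \<phi> V x \<noteq> 0} \<le> card S"
        using gen[rule_format, of "\<lambda>v. \<phi> v x"] x(2) unfolding g_def by blast
      then show "x \<in> X \<and> card S < card {V\<in>\<V>. \<phi> V x \<noteq> 0}" using xX by simp
    qed
  qed
  ultimately show thesis using that by blast
qed

text \<open>On the compact part of \<open>K\<close> outside the cover, the sum of the
  \<open>\<bar>g (\<tau> i x)\<bar>\<close> has a positive lower bound. A function close enough to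
  \<open>g\<close> has no common zero there, so the same cover works for it.\<close>

lemma fine_fibre_stable:
  fixes X K :: "'a::metric_space set" and \<tau> :: "'i \<Rightarrow> 'a \<Rightarrow> 'a" and g :: "'a \<Rightarrow> real"
  assumes K: "compact K" "K \<subseteq> X" and S: "finite S" and g: "continuous_on X g"
    and \<tau>: "\<And>i. i \<in> S \<Longrightarrow> continuous_on K (\<tau> i)" "\<And>i. i \<in> S \<Longrightarrow> \<tau> i ` K \<subseteq> X"
    and fine: "fine_cover X c \<eta> {x\<in>K. \<forall>i\<in>S. g (\<tau> i x) = 0}"
  shows "\<exists>r>0. \<forall>h. (\<forall>x\<in>X. \<bar>h x - g x\<bar> \<le> r) \<longrightarrow>
    fine_cover X c \<eta> {x\<in>K. \<forall>i\<in>S. h (\<tau> i x) = 0}"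
proof -
  obtain \<G> where G: "finite \<G>" "\<forall>G\<in>\<G>. openin (top_of_set X) G"
     "\<forall>G\<in>\<G>. \<forall>x\<in>G. \<forall>y\<in>G. dist x y < \<eta>" "\<forall>x\<in>X. card {G\<in>\<G>. x \<in> G} \<le> c"
     "{x\<in>K. \<forall>i\<in>S. g (\<tau> i x) = 0} \<subseteq> \<Union>\<G>"
    using fine unfolding fine_cover_def by blast
  define s where "s x = (\<Sum>i\<in>S. \<bar>g (\<tau> i x)\<bar>)" for x
  have "openin (top_of_set X) (\<Union>\<G>)" using G(2) by blast
  then obtain O' where O': "open O'" "\<Union>\<G> = X \<inter> O'" by (auto simp: openin_open)
  have KO: "K - \<Union>\<G> = K - O'" using K O' by blast
  then have comp: "compact (K - \<Union>\<G>)" using K O'(1) by (simp add: compact_diff)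
  have "continuous_on K s"
    unfolding s_def using g \<tau>
    by (intro continuous_on_sum continuous_on_rabs continuous_on_compose2[OF g]) auto
  then have conts: "continuous_on (K - \<Union>\<G>) s" by (rule continuous_on_subset) auto
  have pos: "0 < s x" if x: "x \<in> K - \<Union>\<G>" for x
  proof -
    obtain i where i: "i \<in> S" "g (\<tau> i x) \<noteq> 0" using x G(5) by blast
    then have "\<bar>g (\<tau> i x)\<bar> \<le> s x" unfolding s_def using S by (intro member_le_sum) auto
    then show ?thesis using i by linarith
  qed
  obtain q where q: "q > 0" "\<forall>x\<in>K - \<Union>\<G>. q \<le> s x"
  proof (cases "K - \<Union>\<G> = {}")
    case True
    then show ?thesis using that[of 1] by auto
  next
    case False
    then obtain z where "z \<in> K - \<Union>\<G>" "\<forall>x\<in>K - \<Union>\<G>. s z \<le> s x"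
      using continuous_attains_inf[OF comp False conts] by blast
    then show ?thesis using that[of "s z"] pos by blast
  qed
  \<comment> \<open>The \<open>+ 1\<close> keeps the divisor positive for empty \<open>S\<close> and
    makes \<open>card S * r < q\<close> strict.\<close>
  define r where "r = q / (card S + 1)"
  have r: "r > 0" "card S * r < q"
    using q(1) by (auto simp: r_def field_simps)
  have "fine_cover X c \<eta> {x\<in>K. \<forall>i\<in>S. h (\<tau> i x) = 0}" if h: "\<forall>x\<in>X. \<bar>h x - g x\<bar> \<le> r" for h
  proof -
    have "{x\<in>K. \<forall>i\<in>S. h (\<tau> i x) = 0} \<subseteq> \<Union>\<G>"
    proof (rule ccontr)
      assume "\<not> {x\<in>K. \<forall>i\<in>S. h (\<tau> i x) = 0} \<subseteq> \<Union>\<G>"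
      then obtain x where x: "x \<in> K" "\<forall>i\<in>S. h (\<tau> i x) = 0" "x \<notin> \<Union>\<G>" by blast
      have "s x \<le> (\<Sum>i\<in>S. r)"
        unfolding s_def
      proof (rule sum_mono)
        fix i assume i: "i \<in> S"
        then have "\<bar>h (\<tau> i x) - g (\<tau> i x)\<bar> \<le> r" using h \<tau>(2) x(1) by blast
        then show "\<bar>g (\<tau> i x)\<bar> \<le> r" using x(2) i by simp
      qed
      moreover have "q \<le> s x" using q(2) x by blast
      ultimately show False using r(2) by simp
    qed
    then show ?thesis unfolding fine_cover_def using G(1-4) by (intro exI[of _ \<G>]) simp
  qed
  then show ?thesis using r(1) by blast
qed

lemma exists_perturbation_with_fine_fibre:
  fixes X K :: "'a::metric_space set" and \<tau> :: "'i \<Rightarrow> 'a \<Rightarrow> 'a" and f :: "'a \<Rightarrow> real"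
  assumes X: "compact X" "cover_dim_le (top_of_set X) (int n)" and K: "compact K" "K \<subseteq> X"
    and S: "finite S" and f: "continuous_on X f" and "e > 0" "\<eta> > 0"
    and \<tau>: "\<And>i. i \<in> S \<Longrightarrow> continuous_on K (\<tau> i)" "\<And>i. i \<in> S \<Longrightarrow> \<tau> i ` K \<subseteq> X"
      "\<And>i. i \<in> S \<Longrightarrow> inj_on (\<tau> i) K"
    and disj: "\<And>i j. i \<in> S \<Longrightarrow> j \<in> S \<Longrightarrow> i \<noteq> j \<Longrightarrow> \<tau> i ` K \<inter> \<tau> j ` K = {}"
  obtains g where "continuous_on X g" "\<forall>x\<in>X. \<bar>g x - f x\<bar> \<le> e"
    "fine_cover X (n + 1 - card S) \<eta> {x\<in>K. \<forall>i\<in>S. g (\<tau> i x) = 0}"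
proof -
  have fc: "\<forall>i\<in>S. continuous_on K (\<lambda>x. f (\<tau> i x))"
    using \<tau>(1,2) by (intro ballI continuous_on_compose2[OF f])
  obtain G where G: "\<forall>i\<in>S. continuous_on K (G i)" "\<forall>i\<in>S. \<forall>x\<in>K. \<bar>G i x - f (\<tau> i x)\<bar> \<le> e"
    "fine_cover X (n + 1 - card S) \<eta> {x\<in>K. \<forall>i\<in>S. G i x = 0}"
    by (rule exists_approximation_with_fine_fibre[OF X K S fc \<open>e > 0\<close> \<open>\<eta> > 0\<close>])
  define L where "L = (\<Union>i\<in>S. \<tau> i ` K)"
  \<comment> \<open>The correction at \<open>y\<close>: find the unique image containing
    \<open>y\<close>, pull \<open>y\<close> back to \<open>K\<close>, and compare the desired value
    with \<open>f y\<close>.\<close>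
  define D where "D y = (let i = (THE i. i \<in> S \<and> y \<in> \<tau> i ` K) in G i (the_inv_into K (\<tau> i) y) - f y)" for y
  have the: "(THE i. i \<in> S \<and> y \<in> \<tau> i ` K) = i" if "i \<in> S" "y \<in> \<tau> i ` K" for i y
    using that disj by (intro the_equality) blast+
  have cl: "closed (\<tau> i ` K)" if "i \<in> S" for i
    using \<tau>(1)[OF that] K(1) compact_continuous_image compact_imp_closed by blast
  have "continuous_on L D"
    unfolding L_def
  proof (rule continuous_on_closed_Union[OF S cl])
    fix i assume i: "i \<in> S"
    have inv: "continuous_on (\<tau> i ` K) (the_inv_into K (\<tau> i))"
      using \<tau>(1,3)[OF i] K(1) by (intro continuous_on_inv_into)
    have "the_inv_into K (\<tau> i) ` \<tau> i ` K \<subseteq> K"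
      using \<tau>(3)[OF i] by (auto simp: the_inv_into_f_f)
    then have "continuous_on (\<tau> i ` K) (\<lambda>y. G i (the_inv_into K (\<tau> i) y) - f y)"
      using G(1) i \<tau>(2)[OF i] f
      by (intro continuous_on_diff continuous_on_compose2[OF _ inv, of K]) (auto intro: continuous_on_subset)
    then show "continuous_on (\<tau> i ` K) D"
      by (rule continuous_on_eq) (simp add: D_def the[OF i] Let_def)
  qed auto
  have DG: "D (\<tau> i x) = G i x - f (\<tau> i x)" if "i \<in> S" "x \<in> K" for i x
    unfolding D_def using the[OF that(1), of "\<tau> i x"] that \<tau>(3)[OF that(1)]
    by (simp add: the_inv_into_f_f)
  have Dim: "D ` L \<subseteq> {-e..e}"
  proof -
    have "\<bar>D (\<tau> i x)\<bar> \<le> e" if "i \<in> S" "x \<in> K" for i x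
      using DG[OF that] G(2) that by simp
    then show ?thesis by (fastforce simp: L_def abs_le_iff)
  qed
  have Lcl: "closedin (top_of_set X) L"
    unfolding L_def using S cl \<tau>(2) by (intro closed_subset closed_UN) auto
  then have "X \<inter> L = L" using closedin_imp_subset by blast
  then have Dcont: "continuous_map (subtopology (top_of_set X) L) euclideanreal D"
    using \<open>continuous_on L D\<close> by (simp add: subtopology_subtopology)
  have normal: "normal_space (top_of_set X)"
    by (intro metrizable_imp_normal_space metrizable_space_subtopology metrizable_space_euclidean)
  have "-e \<le> e" using \<open>e > 0\<close> by simp
  obtain E where E: "continuous_map (top_of_set X) euclideanreal E" "\<forall>x\<in>L. E x = D x"
    "E ` X \<subseteq> {-e..e}"
  proof (rule Tietze_extension_closed_real_interval[OF normal Lcl Dcont Dim \<open>-e \<le> e\<close>])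
    fix E assume "continuous_map (top_of_set X) euclideanreal E" "\<And>x. x \<in> L \<Longrightarrow> E x = D x"
      "E ` topspace (top_of_set X) \<subseteq> {-e..e}"
    then show thesis by (intro that[of E]) auto
  qed
  show thesis
  proof (rule that)
    show "continuous_on X (\<lambda>x. f x + E x)"
      using E(1) f by (auto intro: continuous_on_add)
    show "\<forall>x\<in>X. \<bar>f x + E x - f x\<bar> \<le> e"
      using E(3) by (fastforce simp: abs_le_iff)
    have "{x\<in>K. \<forall>i\<in>S. f (\<tau> i x) + E (\<tau> i x) = 0} = {x\<in>K. \<forall>i\<in>S. G i x = 0}"
      using E(2) DG by (auto simp: L_def)
    then show "fine_cover X (n + 1 - card S) \<eta> {x\<in>K. \<forall>i\<in>S. f (\<tau> i x) + E (\<tau> i x) = 0}"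
      using G(3) by simp
  qed
qed

section \<open>Aperiodic local homeomorphisms\<close>

lemma local_homeomorphism_onD:
  assumes "local_homeomorphism_on X T"
  shows "T ` X \<subseteq> X" "continuous_on X T"
    "\<And>x. x \<in> X \<Longrightarrow> \<exists>r>0. inj_on T (X \<inter> ball x r)"
proof -
  show TX: "T ` X \<subseteq> X" using assms by (simp add: local_homeomorphism_on_def)
  have loc: "\<exists>G. open G \<and> x \<in> G \<and> continuous_on (X \<inter> G) T \<and> inj_on T (X \<inter> G)" if x: "x \<in> X" for x
  proof -
    obtain W where W: "x \<in> W" "openin (top_of_set X) W"
      "homeomorphic_map (subtopology (top_of_set X) W) (subtopology (top_of_set X) (T ` W)) T"
      using assms x unfolding local_homeomorphism_on_def by blast
    obtain G where G: "open G" "W = X \<inter> G" using W(2) by (auto simp: openin_open)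
    have "subtopology (top_of_set X) W = top_of_set W"
      using G by (simp add: subtopology_subtopology inf.absorb2)
    then have "continuous_map (top_of_set W) (subtopology (top_of_set X) (T ` W)) T" "inj_on T W"
      using W(3) by (auto simp: homeomorphic_map_def intro: quotient_imp_continuous_map)
    then have "continuous_on W T" "inj_on T W"
      by (auto simp: continuous_map_in_subtopology)
    then show ?thesis using W(1) G by blast
  qed
  show "continuous_on X T"
    unfolding continuous_on_eq_continuous_within
  proof
    fix x assume "x \<in> X"
    then obtain G where G: "open G" "x \<in> G" "continuous_on (X \<inter> G) T" using loc by blast
    then have "continuous (at x within X \<inter> G) T"
      using \<open>x \<in> X\<close> by (auto simp: continuous_on_eq_continuous_within)
    then show "continuous (at x within X) T"
      using G at_within_nhd[of x G "X \<inter> G" X] by auto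
  qed
  show "\<exists>r>0. inj_on T (X \<inter> ball x r)" if x: "x \<in> X" for x
  proof -
    obtain G where G: "open G" "x \<in> G" "inj_on T (X \<inter> G)" using loc[OF x] by blast
    then obtain r where "r > 0" "ball x r \<subseteq> G" by (meson open_contains_ball)
    then show ?thesis using G(3) by (intro exI[of _ r]) (auto intro: inj_on_subset)
  qed
qed

lemma continuous_on_funpow:
  assumes "continuous_on X T" "T ` X \<subseteq> X"
  shows "continuous_on X (T ^^ i)" "(T ^^ i) ` X \<subseteq> X"
proof (induction i)
  case (Suc i)
  { case 1
    show ?case using Suc continuous_on_compose2[OF assms(1)] by (simp add: comp_def) }
  { case 2
    show ?case using Suc assms by auto }
qed auto

lemma locally_inj_on_funpow:
  fixes T :: "'a::metric_space \<Rightarrow> 'a"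
  assumes T: "continuous_on X T" "T ` X \<subseteq> X"
    and loc: "\<And>x. x \<in> X \<Longrightarrow> \<exists>r>0. inj_on T (X \<inter> ball x r)" and x: "x \<in> X"
  shows "\<exists>r>0. inj_on (T ^^ i) (X \<inter> ball x r)"
proof (induction i)
  case 0
  show ?case by (auto intro: exI[of _ 1])
next
  case (Suc i)
  then obtain r where r: "r > 0" "inj_on (T ^^ i) (X \<inter> ball x r)" by blast
  have TX: "(T ^^ i) ` X \<subseteq> X" by (rule continuous_on_funpow(2)[OF T])
  then obtain q where q: "q > 0" "inj_on T (X \<inter> ball ((T ^^ i) x) q)" using loc x by blast
  obtain s where s: "s > 0" "\<forall>y\<in>X. dist y x < s \<longrightarrow> dist ((T ^^ i) y) ((T ^^ i) x) < q"
    using continuous_on_funpow(1)[OF T, of i] x q(1) unfolding continuous_on_iff by blast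
  have "inj_on (T \<circ> (T ^^ i)) (X \<inter> ball x (min r s))"
  proof (rule comp_inj_on)
    show "inj_on (T ^^ i) (X \<inter> ball x (min r s))"
      using r(2) by (rule inj_on_subset) auto
    show "inj_on T ((T ^^ i) ` (X \<inter> ball x (min r s)))"
      using q(2) by (rule inj_on_subset) (use s TX in \<open>auto simp: dist_commute\<close>)
  qed
  then show ?case using r(1) s(1) by (intro exI[of _ "min r s"]) (simp add: comp_def)
qed

text \<open>Aperiodicity makes the iterates of \<open>x\<close> distinct, so continuity separates
  them near \<open>x\<close>, while local injectivity passes to iterates. Only finitely many pairs
  \<open>i, j\<close> below \<open>k\<close> have to be handled.\<close>

lemma aperiodic_disjoint_neighbourhood:
  fixes T :: "'a::metric_space \<Rightarrow> 'a"
  assumes T: "continuous_on X T" "T ` X \<subseteq> X"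
    and loc: "\<And>x. x \<in> X \<Longrightarrow> \<exists>r>0. inj_on T (X \<inter> ball x r)"
    and aper: "aperiodic_on X T" and x: "x \<in> X"
  shows "\<exists>r>0. (\<forall>i<k. inj_on (T ^^ i) (X \<inter> cball x r)) \<and>
    (\<forall>i<k. \<forall>j<k. i \<noteq> j \<longrightarrow> (T ^^ i) ` (X \<inter> cball x r) \<inter> (T ^^ j) ` (X \<inter> cball x r) = {})"
proof -
  have ne: "(T ^^ i) x \<noteq> (T ^^ j) x" if "i < j" for i j
  proof
    \<comment> \<open>Equality would make \<open>(T ^^ i) x\<close> a periodic point of period
      \<open>j - i\<close>.\<close>
    assume eq: "(T ^^ i) x = (T ^^ j) x"
    have "(T ^^ (j - i)) ((T ^^ i) x) = (T ^^ i) x"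
      using eq that by (metis comp_apply funpow_add less_imp_le_nat le_add_diff_inverse2)
    moreover have "(T ^^ i) x \<in> X" using continuous_on_funpow(2)[OF T] x by blast
    ultimately show False using aper that unfolding aperiodic_on_def by fastforce
  qed
  have sep: "\<exists>r>0. (T ^^ i) ` (X \<inter> ball x r) \<inter> (T ^^ j) ` (X \<inter> ball x r) = {}" if "i \<noteq> j" for i j
  proof -
    define q where "q = dist ((T ^^ i) x) ((T ^^ j) x) / 2"
    have "(T ^^ i) x \<noteq> (T ^^ j) x" using ne that by (metis linorder_neqE_nat)
    then have q: "q > 0" by (simp add: q_def)
    have "\<exists>s>0. \<forall>y\<in>X. dist y x < s \<longrightarrow> dist ((T ^^ l) y) ((T ^^ l) x) < q" for l
      using continuous_on_funpow(1)[OF T, of l] x q unfolding continuous_on_iff by blast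
    then obtain s where s: "\<forall>l. s l > 0 \<and> (\<forall>y\<in>X. dist y x < s l \<longrightarrow> dist ((T ^^ l) y) ((T ^^ l) x) < q)"
      by metis
    have "(T ^^ i) ` (X \<inter> ball x (min (s i) (s j))) \<inter> (T ^^ j) ` (X \<inter> ball x (min (s i) (s j))) = {}"
    proof (rule ccontr)
      assume "\<not> ?thesis"
      then obtain y z where yz: "y \<in> X" "dist y x < s i" "z \<in> X" "dist z x < s j" "(T ^^ i) y = (T ^^ j) z"
        by (auto simp: dist_commute)
      then have "dist ((T ^^ i) y) ((T ^^ i) x) < q" "dist ((T ^^ i) y) ((T ^^ j) x) < q"
        using s by force+
      then have "dist ((T ^^ i) x) ((T ^^ j) x) < 2 * q"
        by (smt (verit) dist_commute dist_triangle)
      then show False by (simp add: q_def)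
    qed
    then show ?thesis using s by (intro exI[of _ "min (s i) (s j)"]) simp
  qed
  define P where "P i j r \<longleftrightarrow> inj_on (T ^^ i) (X \<inter> ball x r) \<and>
      (i \<noteq> j \<longrightarrow> (T ^^ i) ` (X \<inter> ball x r) \<inter> (T ^^ j) ` (X \<inter> ball x r) = {})" for i j r
  have mono: "P i j s" if "P i j r" "s \<le> r" for i j r s
  proof -
    have sub: "X \<inter> ball x s \<subseteq> X \<inter> ball x r" using that(2) by auto
    show ?thesis
      unfolding P_def
    proof (intro conjI impI)
      show "inj_on (T ^^ i) (X \<inter> ball x s)"
        using that(1) sub unfolding P_def by (blast intro: inj_on_subset)
      assume "i \<noteq> j"
      then show "(T ^^ i) ` (X \<inter> ball x s) \<inter> (T ^^ j) ` (X \<inter> ball x s) = {}"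
        using that(1) image_mono[OF sub, of "T ^^ i"] image_mono[OF sub, of "T ^^ j"]
        unfolding P_def by blast
    qed
  qed
  have "\<exists>r>0. P i j r" for i j
  proof -
    obtain r where r: "r > 0" "inj_on (T ^^ i) (X \<inter> ball x r)"
      using locally_inj_on_funpow[OF T loc x] by blast
    obtain s where s: "s > 0" "i \<noteq> j \<longrightarrow> (T ^^ i) ` (X \<inter> ball x s) \<inter> (T ^^ j) ` (X \<inter> ball x s) = {}"
      using sep[of i j] by (metis zero_less_one)
    have sub: "X \<inter> ball x (min r s) \<subseteq> X \<inter> ball x r" "X \<inter> ball x (min r s) \<subseteq> X \<inter> ball x s" by auto
    have "inj_on (T ^^ i) (X \<inter> ball x (min r s))"
      using r(2) sub(1) by (rule inj_on_subset)
    then have "P i j (min r s)"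
      unfolding P_def using s(2) image_mono[OF sub(2), of "T ^^ i"] image_mono[OF sub(2), of "T ^^ j"]
      by blast
    then show ?thesis using r(1) s(1) by (intro exI[of _ "min r s"]) simp
  qed
  then obtain r where r: "\<forall>i j. r i j > 0 \<and> P i j (r i j)" by metis
  define \<rho> where "\<rho> = Min (insert 1 ((\<lambda>(i,j). r i j) ` ({..<k} \<times> {..<k})))"
  have \<rho>: "\<rho> > 0" using r by (auto simp: \<rho>_def)
  have "P i j \<rho>" if "i < k" "j < k" for i j
  proof (rule mono)
    show "P i j (r i j)" using r by blast
    show "\<rho> \<le> r i j" unfolding \<rho>_def using that by (intro Min_le) auto
  qed
  \<comment> \<open>Halving the radius passes to closed balls, whose intersections with a compact
    \<open>X\<close> are compact.\<close>
  moreover have "X \<inter> cball x (\<rho>/2) \<subseteq> X \<inter> ball x \<rho>" using \<rho> by auto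
  ultimately have "inj_on (T ^^ i) (X \<inter> cball x (\<rho>/2))"
    "i \<noteq> j \<longrightarrow> (T ^^ i) ` (X \<inter> cball x (\<rho>/2)) \<inter> (T ^^ j) ` (X \<inter> cball x (\<rho>/2)) = {}"
    if "i < k" "j < k" for i j
    using that image_mono[of "X \<inter> cball x (\<rho>/2)" "X \<inter> ball x \<rho>"] unfolding P_def
    by (meson inj_on_subset, blast)
  then show ?thesis using \<rho> by (intro exI[of _ "\<rho>/2"]) auto
qed

theorem theorem4p3:
  fixes X :: "'a::metric_space set" and T :: "'a \<Rightarrow> 'a" and d :: int and U :: "'a set"
  assumes "compact X"
    and "has_cover_dim (top_of_set X) d"
    and "local_homeomorphism_on X T"
    and "aperiodic_on X T"
    and "\<And>Z. Z \<subseteq> X \<Longrightarrow> has_cover_dim (top_of_set Z) 0 \<Longrightarrow> has_cover_dim (top_of_set (T ` Z)) 0"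
    and "openin (top_of_set X) U"
  shows "\<forall>(k::nat) V. openin (top_of_set X) V \<and> (top_of_set X) frontier_of U \<subseteq> V \<longrightarrow>
           (\<exists>U'. openin (top_of_set X) U' \<and> U \<subseteq> U' \<and> U' \<subseteq> U \<union> V \<and>
                 (top_of_set X) frontier_of U' \<subseteq> V \<and>
                 general_position (top_of_set X) d {..<k}
                   (\<lambda>i. preim_iter X T i ((top_of_set X) frontier_of U')))"
proof (intro allI impI, elim conjE)
  fix k :: nat and V
  assume V: "openin (top_of_set X) V" "(top_of_set X) frontier_of U \<subseteq> V"
  note T = local_homeomorphism_onD[OF assms(3)]
  note Ti = continuous_on_funpow[OF T(2,1)]
  have dle: "cover_dim_le (top_of_set X) d"
    using assms(2) by (simp add: has_cover_dim_def)
  \<comment> \<open>A negative bound forces \<open>X\<close> to be empty. The empty space satisfies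
    \<open>cover_dim_le\<close> for every integer, hence also for \<open>d - 1\<close>,
    contradicting exactness of \<open>d\<close>.\<close>
  have "d \<ge> 0"
  proof (rule ccontr)
    assume neg: "\<not> d \<ge> 0"
    have "X = {}"
    proof (rule ccontr)
      assume "X \<noteq> {}"
      then obtain x where x: "x \<in> X" by blast
      obtain \<V> where "finite \<V>" "\<Union>\<V> = X" "\<forall>x\<in>X. int (card {V\<in>\<V>. x \<in> V}) \<le> d + 1"
        using compact_cover_dim_leD[OF assms(1) dle, of 1] by auto
      moreover from this obtain W where "W \<in> \<V>" "x \<in> W" using x by blast
      ultimately have "{V\<in>\<V>. x \<in> V} \<noteq> {}" "finite {V\<in>\<V>. x \<in> V}" "int (card {V\<in>\<V>. x \<in> V}) \<le> d + 1"
        using x by auto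
      then have "card {V\<in>\<V>. x \<in> V} > 0" "int (card {V\<in>\<V>. x \<in> V}) \<le> d + 1"
        using card_gt_0_iff by blast+
      then show False using neg by linarith
    qed
    then have "cover_dim_le (top_of_set X) (d - 1)"
      by (auto simp: cover_dim_le_def intro: exI[of _ "{}"])
    then show False using assms(2) by (simp add: has_cover_dim_def)
  qed
  then obtain n where n: "d = int n" using nonneg_int_cases by blast
  have dimX: "cover_dim_le (top_of_set X) (int n)" using dle n by simp

  \<comment> \<open>Compact pieces on which the iterates are injective with disjoint images\<close>
  have "\<forall>x\<in>X. \<exists>r>0. (\<forall>i<k. inj_on (T ^^ i) (X \<inter> cball x r)) \<and>
    (\<forall>i<k. \<forall>j<k. i \<noteq> j \<longrightarrow> (T ^^ i) ` (X \<inter> cball x r) \<inter> (T ^^ j) ` (X \<inter> cball x r) = {})"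
    using aperiodic_disjoint_neighbourhood[OF T(2,1,3) assms(4)] by blast
  then obtain r where r: "\<forall>x\<in>X. r x > 0 \<and> (\<forall>i<k. inj_on (T ^^ i) (X \<inter> cball x (r x))) \<and>
    (\<forall>i<k. \<forall>j<k. i \<noteq> j \<longrightarrow> (T ^^ i) ` (X \<inter> cball x (r x)) \<inter> (T ^^ j) ` (X \<inter> cball x (r x)) = {})"
    by metis
  obtain N where N: "N \<subseteq> X" "finite N" "X \<subseteq> (\<Union>x\<in>N. ball x (r x))"
    by (rule compactE_image[OF assms(1), of X "\<lambda>x. ball x (r x)"]) (use r in auto)
  define K where "K x = X \<inter> cball x (r x)" for x
  have K: "compact (K x)" "K x \<subseteq> X" for x
    using assms(1) by (auto simp: K_def compact_Int_closed)
  have KX: "X = (\<Union>x\<in>N. K x)" using N(3) by (force simp: K_def)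
  have Kinj: "\<forall>x\<in>N. \<forall>i<k. inj_on (T ^^ i) (K x)"
    and Kdisj: "\<forall>x\<in>N. \<forall>i<k. \<forall>j<k. i \<noteq> j \<longrightarrow> (T ^^ i) ` K x \<inter> (T ^^ j) ` K x = {}"
    using r N(1) unfolding K_def by blast+

  \<comment> \<open>The countably many conditions on the function\<close>
  define J where "J = N \<times> Pow {..<k} \<times> (UNIV :: nat set)"
  \<comment> \<open>One condition per piece, set of iterates and scale. The guard makes
    \<open>Q\<close> trivial for triples outside \<open>J\<close>, so every index satisfies
    \<open>Q_approx\<close>, also when \<open>J\<close> is empty and its enumeration yields an
    arbitrary triple.\<close>
  define Q where "Q = (\<lambda>(x, S, m) f. x \<in> N \<and> S \<subseteq> {..<k} \<longrightarrow>
      fine_cover X (n + 1 - card S) (1 / Suc m) {y \<in> K x. \<forall>i\<in>S. f ((T ^^ i) y) = (0::real)})"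
  have Q_approx: "\<exists>g. continuous_on X g \<and> (\<forall>x\<in>X. \<bar>g x - f x\<bar> \<le> e) \<and>
        (\<exists>r>0. \<forall>h. (\<forall>x\<in>X. \<bar>h x - g x\<bar> \<le> r) \<longrightarrow> Q j h)"
    if f: "continuous_on X f" and e: "e > 0" for f e j
  proof -
    obtain x S m where j: "j = (x, S, m)" by (metis prod_cases3)
    show ?thesis
    proof (cases "x \<in> N \<and> S \<subseteq> {..<k}")
      case False
      then show ?thesis using f e j by (auto simp: Q_def intro!: exI[of _ f] exI[of _ 1])
    next
      case True
      have S: "finite S" using True finite_subset by blast
      have c: "continuous_on (K x) (T ^^ i)" for i using Ti(1) K(2) continuous_on_subset by blast
      have s: "(T ^^ i) ` K x \<subseteq> X" for i using Ti(2) K(2) by blast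
      obtain g where g: "continuous_on X g" "\<forall>x\<in>X. \<bar>g x - f x\<bar> \<le> e"
        "fine_cover X (n + 1 - card S) (1 / Suc m) {y\<in>K x. \<forall>i\<in>S. g ((T ^^ i) y) = 0}"
      proof (rule exists_perturbation_with_fine_fibre[OF assms(1) dimX K S f e _ c s])
        show "inj_on (T ^^ i) (K x)" if "i \<in> S" for i using Kinj True that by blast
        show "(T ^^ i) ` K x \<inter> (T ^^ j) ` K x = {}" if "i \<in> S" "j \<in> S" "i \<noteq> j" for i j
          using Kdisj True that by blast
      qed auto
      show ?thesis
        using fine_fibre_stable[OF K S g(1) c s g(3)] g(1,2) unfolding Q_def j by (intro exI[of _ g]) auto
    qed
  qed

  \<comment> \<open>A function separating the closure of \<open>U\<close> from the complement of
    \<open>U \<union> V\<close>\<close>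
  have clU: "closedin (top_of_set X) ((top_of_set X) closure_of U)" by simp
  have clUV: "closedin (top_of_set X) (X - (U \<union> V))"
    using V(1) assms(6) by (metis closedin_diff closedin_topspace openin_Un topspace_euclidean_subtopology)
  have "(top_of_set X) closure_of U \<subseteq> U \<union> V"
    using V(2) assms(6) by (auto simp: frontier_of_def interior_of_openin)
  then have dj: "disjnt (X - (U \<union> V)) ((top_of_set X) closure_of U)" by (auto simp: disjnt_def)
  have normal: "normal_space (top_of_set X)"
    by (intro metrizable_imp_normal_space metrizable_space_subtopology metrizable_space_euclidean)
  obtain f0 :: "'a \<Rightarrow> real" where f0: "continuous_map (top_of_set X) euclideanreal f0"
      "f0 ` (X - (U \<union> V)) \<subseteq> {-1}" "f0 ` ((top_of_set X) closure_of U) \<subseteq> {1}"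
    by (rule Urysohn_lemma_alt[OF normal clUV clU dj])
  then have f0c: "continuous_on X f0" by simp

  define P where "P m = Q (from_nat_into J m)" for m
  \<comment> \<open>An error of at most 1/2 preserves the signs of the values 1 and -1 of
    \<open>f0\<close>.\<close>
  obtain f where f: "continuous_on X f" "\<And>x. x \<in> X \<Longrightarrow> \<bar>f x - f0 x\<bar> \<le> 1/2" "\<And>m. P m f"
  proof (rule exists_approximation_satisfying_countably_many[of X P f0 "1/2"])
    fix m and f :: "'a \<Rightarrow> real" and e :: real
    assume "continuous_on X f" "e > 0"
    then show "\<exists>g. continuous_on X g \<and> (\<forall>x\<in>X. \<bar>g x - f x\<bar> \<le> e) \<and>
        (\<exists>r>0. \<forall>h. (\<forall>x\<in>X. \<bar>h x - g x\<bar> \<le> r) \<longrightarrow> P m h)"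
      unfolding P_def by (rule Q_approx)
  qed (use f0c in auto)
  have "countable J" unfolding J_def using N(2) by (intro countable_SIGMA) (auto intro: countable_finite)
  have Qf: "Q j f" if "j \<in> J" for j
    using f(3) from_nat_into_surj[OF \<open>countable J\<close> that] unfolding P_def by metis

  \<comment> \<open>The open set \<open>U'\<close> and its frontier\<close>
  define U' where "U' = {x\<in>X. f x > 0}"
  have opU': "openin (top_of_set X) U'"
    using continuous_openin_preimage_gen[OF f(1), of "{0<..}"] by (simp add: U'_def vimage_def Int_def)
  have cl0: "closedin (top_of_set X) {x\<in>X. f x \<ge> 0}"
    using continuous_closedin_preimage[OF f(1), of "{0..}"] by (simp add: vimage_def Int_def)
  have UU': "(top_of_set X) closure_of U \<subseteq> U'"
  proof
    fix x assume x: "x \<in> (top_of_set X) closure_of U"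
    then have "x \<in> X" using closure_of_subset_topspace by fastforce
    moreover have "f0 x = 1" using f0(3) x by blast
    moreover have "\<bar>f x - f0 x\<bar> \<le> 1/2" by (rule f(2)[OF \<open>x \<in> X\<close>])
    ultimately show "x \<in> U'" unfolding U'_def by (simp; linarith)
  qed
  have neg: "f x < 0" if "x \<in> X - (U \<union> V)" for x
  proof -
    have "f0 x = -1" using f0(2) that by blast
    moreover have "\<bar>f x - f0 x\<bar> \<le> 1/2" using f(2) that by blast
    ultimately show ?thesis by linarith
  qed
  have "(top_of_set X) closure_of U' \<subseteq> {x\<in>X. f x \<ge> 0}"
    by (intro closure_of_minimal cl0) (auto simp: U'_def)
  \<comment> \<open>An inclusion suffices: dimension bounds are derived from fine covers of the zero
    fibres, and these restrict to the smaller closed set \<open>A\<close> below.\<close>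
  then have fr: "(top_of_set X) frontier_of U' \<subseteq> {x\<in>X. f x = 0}"
    using opU' by (force simp: frontier_of_def interior_of_openin U'_def)
  have "U \<subseteq> U'"
    using UU' closure_of_subset[of U "top_of_set X"] assms(6) openin_subset by blast
  moreover have "U' \<subseteq> U \<union> V"
    using neg by (force simp: U'_def)
  moreover have "(top_of_set X) frontier_of U' \<subseteq> V"
  proof
    fix x assume "x \<in> (top_of_set X) frontier_of U'"
    then have x: "x \<in> X" "f x = 0" using fr by auto
    then have "x \<in> U \<union> V" using neg[of x] by auto
    moreover have "x \<notin> U" using \<open>U \<subseteq> U'\<close> x by (auto simp: U'_def)
    ultimately show "x \<in> V" by blast
  qed

  \<comment> \<open>General position of the preimages of the frontier\<close>
  moreover have "general_position (top_of_set X) d {..<k}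
     (\<lambda>i. preim_iter X T i ((top_of_set X) frontier_of U'))"
    unfolding general_position_def
  proof (intro allI impI, elim conjE)
    fix S assume S: "S \<subseteq> {..<k}" "finite S" "S \<noteq> {}"
    define A where "A = (\<Inter>i\<in>S. preim_iter X T i ((top_of_set X) frontier_of U'))"
    have AX: "A \<subseteq> X" using S(3) by (auto simp: A_def preim_iter_def)
    have A0: "\<forall>i\<in>S. f ((T ^^ i) x) = 0" if "x \<in> A" for x
      using that fr by (auto simp: A_def preim_iter_def)
    have "closedin (top_of_set X) A"
      unfolding A_def
    proof (rule closedin_INT[OF S(3)])
      fix i
      have "closedin (top_of_set X) ((top_of_set X) frontier_of U')" by (simp add: closedin_frontier_of)
      then have "closedin (top_of_set X) (X \<inter> (T ^^ i) -` ((top_of_set X) frontier_of U'))"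
        using continuous_closedin_preimage_gen[OF Ti(1)] Ti(2) image_subset_iff_funcset by blast
      then show "closedin (top_of_set X) (preim_iter X T i ((top_of_set X) frontier_of U'))"
        by (simp add: preim_iter_def vimage_def Int_def)
    qed
    then have "compact A" using assms(1) closedin_compact by blast
    have "cover_dim_le (top_of_set (A \<inter> K x)) (int (n + 1 - card S) - 1)" if x: "x \<in> N" for x
    proof (rule cover_dim_le_if_fine_covers[where X = X])
      show "compact (A \<inter> K x)" using \<open>compact A\<close> K(1) compact_Int by blast
      show "A \<inter> K x \<subseteq> X" using AX by blast
      fix e :: real assume "e > 0"
      then obtain m where m: "1 / Suc m < e" using nat_approx_posE by blast
      have "fine_cover X (n + 1 - card S) (1 / Suc m) {y \<in> K x. \<forall>i\<in>S. f ((T ^^ i) y) = 0}"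
        using Qf[of "(x, S, m)"] x S by (auto simp: Q_def J_def)
      then have "fine_cover X (n + 1 - card S) (1 / Suc m) (A \<inter> K x)"
        by (rule fine_cover_mono) (use A0 in auto)
      then show "fine_cover X (n + 1 - card S) e (A \<inter> K x)"
        unfolding fine_cover_def using m by (meson less_trans)
    qed
    moreover have "closed (A \<inter> K x)" for x
      using \<open>compact A\<close> K(1) compact_Int compact_imp_closed by blast
    ultimately have "cover_dim_le (top_of_set (\<Union>x\<in>N. A \<inter> K x)) (int (n + 1 - card S) - 1)"
      using cover_dim_le_finite_closed_Union[OF N(2), of "\<lambda>x. A \<inter> K x"] by blast
    moreover have "(\<Union>x\<in>N. A \<inter> K x) = X \<inter> A" using AX KX by blast
    \<comment> \<open>Truncated subtraction supplies the maximum: for \<open>card S > n\<close> the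
      left side is -1.\<close>
    moreover have "int (n + 1 - card S) - 1 = max (-1) (d - int (card S))" using n by auto
    ultimately show "cover_dim_le (subtopology (top_of_set X)
        (\<Inter>i\<in>S. preim_iter X T i ((top_of_set X) frontier_of U'))) (max (-1) (d - int (card S)))"
      by (simp add: subtopology_subtopology A_def)
  qed
  ultimately show "\<exists>U'. openin (top_of_set X) U' \<and> U \<subseteq> U' \<and> U' \<subseteq> U \<union> V \<and>
                 (top_of_set X) frontier_of U' \<subseteq> V \<and>
                 general_position (top_of_set X) d {..<k}
                   (\<lambda>i. preim_iter X T i ((top_of_set X) frontier_of U'))"
    using opU' by blast
qed

end
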